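(* Let $p$ be an odd prime, $e\ge1$ an integer, and let $g$ be a primitive root modulo $p^e$. Then for each $x\in\{1,2,\ldots,p^e\}$ that is a unit modulo $p$, there exists a unique value of $c\in\{1,2,\ldots,(p-1)\cdot p^{e-1}\}$ such that $$g^{x-1+c}\equiv x\pmod{p^e}.$$
   Context: A primitive root modulo $p^e$ is an integer whose multiplicative order modulo $p^e$ is $p^{e-1}(p-1)$. *)

theory Defs
  imports "HOL-Number_Theory.Number_Theory"
begin

text \<open>
  The library notion \<open>residue_primroot\<close> is restricted to natural numbers, but \<open>ord\<close> is polymorphic
  and is used here on integers. Since \<open>ord n a = 0\<close> when \<open>n\<close> and \<open>a\<close> are not coprime, coprimality
  of \<open>g\<close> and \<open>p\<close> follows from the equation for prime \<open>p\<close>.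
\<close>
definition primitive_root_mod_prime_power :: "nat \<Rightarrow> nat \<Rightarrow> int \<Rightarrow> bool" where
  "primitive_root_mod_prime_power p e g \<longleftrightarrow> ord (int p ^ e) g = p ^ (e - 1) * (p - 1)"

end

theory Submission
  imports Defs
begin

text \<open>
  Powers of a generator \<open>a\<close> of the units modulo \<open>m\<close> depend exactly on the exponent modulo
  \<open>totient m\<close>. Writing \<open>x\<close> as \<open>a ^ i\<close>, the condition on \<open>c\<close> becomes
  \<open>[x - 1 + c = i] (mod totient m)\<close>, which has one solution in a complete residue system.
\<close>

text \<open>\<open>ord\<close> is built only from coprimality and the congruences
  \<open>[a ^ d = 1]\<close>, and the embedding of naturals into integers preserves both. With
  \<open>ord_cong_int\<close>, this carries the order of an integer over to a natural
  representative.\<close>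

lemma ord_of_nat_int: "ord (int n) (int a) = ord n a"
proof -
  have "[int a ^ d = 1] (mod int n) \<longleftrightarrow> [a ^ d = 1] (mod n)" for d
    using cong_int_iff[of "a ^ d" 1 n] by simp
  then show ?thesis
    by (simp add: ord_def)
qed

lemma ord_cong_int:
  fixes n a b :: int
  assumes "[a = b] (mod n)"
  shows "ord n a = ord n b"
proof -
  have "coprime n a \<longleftrightarrow> coprime n b"
    using assms by (metis cong_imp_coprime cong_sym coprime_commute)
  moreover have "[a ^ d = 1] (mod n) \<longleftrightarrow> [b ^ d = 1] (mod n)" for d
    using cong_pow[OF assms, of d] by (auto simp: cong_def)
  ultimately show ?thesis
    by (simp add: ord_def)
qed

lemma ex1_shifted_cong:
  fixes k i t :: nat
  assumes "t > 0"
  shows "\<exists>!c. c \<in> {1..t} \<and> [k + c = i] (mod t)"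
proof
  \<comment> \<open>The summand \<open>k * (t - 1)\<close> stands for -k modulo \<open>t\<close>,
    which avoids truncated subtraction.\<close>
  define r where "r = (i + k * (t - 1)) mod t"
  \<comment> \<open>The range starts at 1, so residue 0 is represented by \<open>t\<close>.\<close>
  define c where "c = (if r = 0 then t else r)"
  have "[c = i + k * (t - 1)] (mod t)"
    by (simp add: c_def r_def cong_def)
  then have "[k + c = k + (i + k * (t - 1))] (mod t)"
    by (intro cong_add cong_refl)
  also have "k + (i + k * (t - 1)) = i + t * k"
    using assms by (cases t) (auto simp: algebra_simps)
  also have "[i + t * k = i] (mod t)"
    by (simp add: cong_def)
  finally have cong: "[k + c = i] (mod t)" .
  have "c \<in> {1..t}"
    using assms mod_less_divisor[OF assms, of "i + k * (t - 1)"] by (auto simp: c_def r_def)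
  with cong show "c \<in> {1..t} \<and> [k + c = i] (mod t)" by blast
  fix d assume d: "d \<in> {1..t} \<and> [k + d = i] (mod t)"
  then have "[k + d = k + c] (mod t)"
    using cong cong_sym cong_trans by blast
  then have "[d = c] (mod t)"
    by (simp add: cong_add_lcancel_nat)
  \<comment> \<open>In \<open>{1..t}\<close> only \<open>t\<close> has residue 0; every other
    element is its own residue.\<close>
  then show "d = c"
    using d \<open>c \<in> {1..t}\<close> by (cases "d = t"; cases "c = t") (auto simp: cong_def)
qed

lemma residue_primroot_ex1_shifted_exponent:
  assumes "m > 1" "residue_primroot m a" "coprime x m"
  shows "\<exists>!c. c \<in> {1..totient m} \<and> [a ^ (k + c) = x] (mod m)"
proof -
  \<comment> \<open>Totatives are positive, so 0 must be excluded: it is coprime to \<open>m\<close>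
    only when \<open>m = 1\<close>.\<close>
  have "x mod m \<noteq> 0"
    using assms by (metis coprime_0_left_iff coprime_mod_left_iff
        nat_dvd_1_iff_1 less_irrefl_nat not_gr_zero less_zeroE)
  then have "x mod m \<in> totatives m"
    using assms by (simp add: totatives_def less_imp_le)
  then have "x mod m \<in> (\<lambda>i. a ^ i mod m) ` {..<totient m}"
    using residue_primroot_is_generator[OF assms(1,2)] by (simp add: bij_betw_def)
  then obtain i where i: "[a ^ i = x] (mod m)"
    by (auto simp: cong_def)
  have "[a ^ (k + c) = x] (mod m) \<longleftrightarrow> [k + c = i] (mod totient m)" for c
  proof -
    have "[a ^ (k + c) = x] (mod m) \<longleftrightarrow> [a ^ (k + c) = a ^ i] (mod m)"
      using i by (auto simp: cong_def)
    also have "\<dots> \<longleftrightarrow> [k + c = i] (mod totient m)"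
      using assms(2) by (simp add: residue_primroot_def order_divides_expdiff)
    finally show ?thesis .
  qed
  then show ?thesis
    using assms(1) by (simp only: ex1_shifted_cong totient_gt_0_iff)
qed

theorem lemma4:
  fixes p e :: nat and g :: int
  assumes "prime p" and "odd p" and "e \<ge> 1"
    and "primitive_root_mod_prime_power p e g"
  shows "\<forall>x \<in> {1..p ^ e}. coprime x p \<longrightarrow>
           (\<exists>!c. c \<in> {1..(p - 1) * p ^ (e - 1)} \<and> [g ^ (x - 1 + c) = int x] (mod (int p ^ e)))"
proof (intro ballI impI)
  fix x assume x: "x \<in> {1..p ^ e}" "coprime x p"
  define m where "m = p ^ e"
  \<comment> \<open>\<open>residue_primroot\<close> lives on naturals, so \<open>g\<close>, possibly
    negative, is replaced by its least nonnegative residue.\<close>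
  define a where "a = nat (g mod int m)"
  have m: "m > 1"
    unfolding m_def using assms by (intro one_less_power prime_gt_1_nat) auto
  have totient: "totient m = (p - 1) * p ^ (e - 1)"
    using assms by (simp add: m_def totient_prime_power mult.commute)
  have a: "[int a = g] (mod int m)"
    using m by (simp add: a_def cong_def)
  have "ord m a = totient m"
    using assms(4) ord_cong_int[OF a] ord_of_nat_int[of m a]
    unfolding totient by (simp add: primitive_root_mod_prime_power_def m_def mult.commute)
  \<comment> \<open>Coprimality comes from the order itself, which equals
    \<open>totient m > 0\<close>.\<close>
  with m have "residue_primroot m a"
    by (auto simp: residue_primroot_def simp flip: ord_gt_0_iff)
  moreover have "coprime x m"
    using x by (simp add: m_def)
  \<comment> \<open>As \<open>x\<close> is fixed before \<open>c\<close>, the offset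
    \<open>x - 1\<close> is a constant shift \<open>k\<close>.\<close>
  ultimately have "\<exists>!c. c \<in> {1..totient m} \<and> [a ^ (x - 1 + c) = x] (mod m)"
    using m by (intro residue_primroot_ex1_shifted_exponent)
  moreover have "[a ^ n = x] (mod m) \<longleftrightarrow> [g ^ n = int x] (mod int p ^ e)" for n
  proof -
    have "[a ^ n = x] (mod m) \<longleftrightarrow> [int a ^ n = int x] (mod int m)"
      by (simp flip: cong_int_iff)
    also have "\<dots> \<longleftrightarrow> [g ^ n = int x] (mod int m)"
      using cong_pow[OF a, of n] by (auto simp: cong_def)
    finally show ?thesis
      by (simp add: m_def)
  qed
  ultimately show "\<exists>!c. c \<in> {1..(p - 1) * p ^ (e - 1)} \<and>
      [g ^ (x - 1 + c) = int x] (mod (int p ^ e))"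
    by (simp only: totient)
qed

end
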